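(* Let $\mathcal X$ be a normed vector space, $\mathcal Y$ an inner product space, $T,T_n:\mathcal X\to\mathcal Y$ ($n=1,2,\dots$) bounded linear operators, $y,y_n\in\mathcal Y$, $\alpha>0$, $\alpha_n\in\mathbb R$, $\mathcal D$ a subset of $\mathcal X$, and $W:\mathcal D\to\mathbb R$ a functional satisfying: (1) there exists $\gamma\ge 0$ such that $W(x)\ge-\gamma$ for all $x\in\mathcal D$; (2) for every $W$-bounded sequence $\{x_n\}\subset\mathcal D$ converging weakly to some $x\in\mathcal D$, there exists a subsequence $\{x_{n_j}\}$ such that $W(x)\le\liminf_{j\to\infty}W(x_{n_j})$; (3) for every $W$-bounded sequence $\{x_n\}\subset\mathcal D$ there exist a subsequence $\{x_{n_j}\}$ and $x\in\mathcal D$ such that $x_{n_j}$ converges weakly to $x$. Define on $\mathcal D$ the functionals $$J(x)=\|Tx-y\|^2+\alpha W(x),\qquad J_n(x)=\|T_nx-y_n\|^2+\alpha_nW(x),\quad n=1,2,\dots,$$ and assume that as $n\to\infty$, $\alpha_n\to\alpha$, $y_n\to y$ and $T_nx\to Tx$ uniformly for $x$ in $W$-bounded sets. Suppose further that $J$ has a unique global minimizer $\bar x$ on $\mathcal D$. If, for each $n$, $x_n$ is a global minimizer of $J_n$ on $\mathcal D$, then $x_n$ converges weakly to $\bar x$.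
   Context: A sequence or subset of $\mathcal D$ is $W$-bounded if there is a constant $k<\infty$ with $|W(x)|\le k$ for all its elements $x$. "$T_nx\to Tx$ uniformly for $x$ in $W$-bounded sets" means: for any $c>0$ and $\epsilon>0$ there exists $N$ such that $\|T_nx-Tx\|<\epsilon$ for every $n\ge N$ and every $x\in\mathcal D$ with $|W(x)|\le c$. *)

theory Defs
  imports "HOL-Analysis.Analysis"
begin

definition weakly_tendsto :: "(nat \<Rightarrow> 'a::real_normed_vector) \<Rightarrow> 'a \<Rightarrow> bool" where
  "weakly_tendsto s x \<longleftrightarrow>
     (\<forall>f :: 'a \<Rightarrow> real. bounded_linear f \<longrightarrow> (\<lambda>n. f (s n)) \<longlonglongrightarrow> f x)"

text \<open>A functional \<open>W : D \<rightarrow> \<real>\<close> is represented by a total function; all notions below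
  only refer to its values on \<open>D\<close>.\<close>

definition W_bounded :: "'a set \<Rightarrow> ('a \<Rightarrow> real) \<Rightarrow> 'a set \<Rightarrow> bool" where
  "W_bounded D W S \<longleftrightarrow> S \<subseteq> D \<and> (\<exists>k. \<forall>x\<in>S. \<bar>W x\<bar> \<le> k)"

definition uniform_on_W_bounded ::
  "'a set \<Rightarrow> ('a \<Rightarrow> real) \<Rightarrow> (nat \<Rightarrow> 'a \<Rightarrow> 'b::real_normed_vector) \<Rightarrow> ('a \<Rightarrow> 'b) \<Rightarrow> bool" where
  "uniform_on_W_bounded D W Tn T \<longleftrightarrow>
     (\<forall>c>0. \<forall>\<epsilon>>0. \<exists>N. \<forall>n\<ge>N. \<forall>x\<in>D. \<bar>W x\<bar> \<le> c \<longrightarrow> norm (Tn n x - T x) < \<epsilon>)"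

definition reg_functional ::
  "('a \<Rightarrow> 'b::real_normed_vector) \<Rightarrow> 'b \<Rightarrow> real \<Rightarrow> ('a \<Rightarrow> real) \<Rightarrow> 'a \<Rightarrow> real" where
  "reg_functional T y \<alpha> W x = (norm (T x - y))\<^sup>2 + \<alpha> * W x"

abbreviation is_global_minimizer :: "('a \<Rightarrow> real) \<Rightarrow> 'a set \<Rightarrow> 'a \<Rightarrow> bool" where
  "is_global_minimizer J D x \<equiv> is_arg_min J (\<lambda>z. z \<in> D) x"

end

theory Submission
  imports Defs
begin

text \<open>
  The minimizers \<open>xn n\<close> are eventually \<open>W\<close>-bounded: comparing with \<open>xbar\<close> gives
  \<open>\<alpha>n n * W (xn n) \<le> J\<^sub>n xbar\<close>, where the right-hand side converges and \<open>\<alpha>n n\<close> stays away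
  from \<open>0\<close>. So every subsequence has, by the compactness hypothesis, a further subsequence
  converging weakly to some \<open>x \<in> D\<close>, along which \<open>W\<close> may be taken to be lower semicontinuous.
  Such an \<open>x\<close> minimizes \<open>J\<close>. Indeed, with \<open>v = T x - y\<close>, the inner products of \<open>v\<close> with the
  residuals \<open>Tn n (xn n) - yn n\<close> converge along this subsequence to \<open>\<parallel>v\<parallel>\<^sup>2\<close>, and the elementary
  inequality \<open>\<parallel>p\<parallel>\<^sup>2 \<ge> 2 \<langle>v, p\<rangle> - \<parallel>v\<parallel>\<^sup>2\<close> turns this into the lower bound \<open>\<parallel>v\<parallel>\<^sup>2\<close> for their
  squared norms in the limit; hence \<open>J x\<close> is at most the limit of \<open>J\<^sub>n z\<close>, which is \<open>J z\<close>, for every competitor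
  \<open>z\<close>. By uniqueness \<open>x = xbar\<close>, and a sequence all of whose subsequences have a further
  subsequence with the same weak limit converges weakly to that limit.
\<close>

text \<open>Testing against one functional at a time reduces the claim to real sequences: a subsequence
  on which \<open>f\<close> stays away from \<open>f x\<close> has no weakly convergent refinement with limit \<open>x\<close>.\<close>

lemma weakly_tendsto_if_subsequences:
  fixes s :: "nat \<Rightarrow> 'a::real_normed_vector"
  assumes sub: "\<And>r :: nat \<Rightarrow> nat. strict_mono r \<Longrightarrow>
    \<exists>q :: nat \<Rightarrow> nat. strict_mono q \<and> weakly_tendsto (s \<circ> r \<circ> q) x"
  shows "weakly_tendsto s x"
  unfolding weakly_tendsto_def
proof (intro allI impI, rule ccontr)
  fix f :: "'a \<Rightarrow> real"
  assume f: "bounded_linear f" and not_lim: "\<not> (\<lambda>n. f (s n)) \<longlonglongrightarrow> f x"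
  then obtain e where e: "e > 0" and far: "\<And>N. \<exists>n\<ge>N. e \<le> dist (f (s n)) (f x)"
    unfolding lim_sequentially by (meson not_le)
  have "infinite {n. e \<le> dist (f (s n)) (f x)}"
    using far unfolding infinite_nat_iff_unbounded_le by auto
  then obtain r :: "nat \<Rightarrow> nat" where r: "strict_mono r"
    and far_r: "\<And>n. e \<le> dist (f (s (r n))) (f x)"
    using infinite_enumerate by (metis (mono_tags, lifting) mem_Collect_eq)
  from sub[OF r] f obtain q where "(\<lambda>n. f (s (r (q n)))) \<longlonglongrightarrow> f x"
    by (auto simp: weakly_tendsto_def o_def)
  then obtain n where "dist (f (s (r (q n)))) (f x) < e"
    using e unfolding lim_sequentially by blast
  with far_r[of "q n"] show False by simp
qed

lemma weakly_tendsto_subseq: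
  assumes "weakly_tendsto s x" "strict_mono q"
  shows "weakly_tendsto (s \<circ> q) x"
  unfolding weakly_tendsto_def
proof (intro allI impI)
  fix f :: "'a \<Rightarrow> real"
  assume "bounded_linear f"
  then have "(\<lambda>n. f (s n)) \<longlonglongrightarrow> f x"
    using assms(1) by (simp add: weakly_tendsto_def)
  from LIMSEQ_subseq_LIMSEQ[OF this assms(2)]
  show "(\<lambda>n. f ((s \<circ> q) n)) \<longlonglongrightarrow> f x"
    by (simp add: o_def)
qed

lemma uniform_on_W_bounded_diff_tendsto_0:
  assumes unif: "uniform_on_W_bounded D W Tn T"
    and bdd: "W_bounded D W (range u)"
    and m: "filterlim m at_top sequentially"
  shows "(\<lambda>j. Tn (m j) (u j) - T (u j)) \<longlonglongrightarrow> 0"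
proof (rule tendstoI)
  fix e :: real
  assume "e > 0"
  obtain k where uD: "\<And>j. u j \<in> D" and k: "\<And>j. \<bar>W (u j)\<bar> \<le> k"
    using bdd by (auto simp: W_bounded_def)
  define c where "c = max k 1"
  have "c > 0" and c: "\<And>j. \<bar>W (u j)\<bar> \<le> c"
    using k by (auto simp: c_def le_max_iff_disj)
  with unif \<open>e > 0\<close> obtain N where
    N: "\<And>n x. \<lbrakk>n \<ge> N; x \<in> D; \<bar>W x\<bar> \<le> c\<rbrakk> \<Longrightarrow> norm (Tn n x - T x) < e"
    unfolding uniform_on_W_bounded_def by meson
  have "eventually (\<lambda>j. m j \<ge> N) sequentially"
    using m by (simp add: filterlim_at_top)
  then show "eventually (\<lambda>j. dist (Tn (m j) (u j) - T (u j)) 0 < e) sequentially"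
    by eventually_elim (use N uD c in simp)
qed

lemma reg_functional_tendsto:
  assumes unif: "uniform_on_W_bounded D W Tn T"
    and "yn \<longlonglongrightarrow> y" "\<alpha>n \<longlonglongrightarrow> \<alpha>" and z: "z \<in> D"
  shows "(\<lambda>n. reg_functional (Tn n) (yn n) (\<alpha>n n) W z) \<longlonglongrightarrow> reg_functional T y \<alpha> W z"
proof -
  have "W_bounded D W (range (\<lambda>_ :: nat. z))"
    using z by (auto simp: W_bounded_def)
  from uniform_on_W_bounded_diff_tendsto_0[OF unif this filterlim_ident]
  have "(\<lambda>n. Tn n z) \<longlonglongrightarrow> T z"
    by (simp add: LIM_zero_iff)
  with assms(2,3) show ?thesis
    unfolding reg_functional_def by (intro tendsto_intros)
qed

text \<open>The squared residual is nonnegative, so the penalty alone is controlled by the value of the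
  functional at a fixed competitor; dividing by \<open>\<alpha>n n > \<alpha> / 2\<close> bounds \<open>W\<close> from above.\<close>

lemma minimizers_eventually_W_bounded:
  assumes unif: "uniform_on_W_bounded D W Tn T"
    and y: "yn \<longlonglongrightarrow> y" and a: "\<alpha>n \<longlonglongrightarrow> \<alpha>" and pos: "\<alpha> > 0"
    and below: "\<And>x. x \<in> D \<Longrightarrow> W x \<ge> - \<gamma>"
    and z: "z \<in> D"
    and min: "\<And>n. n \<ge> 1 \<Longrightarrow>
       is_global_minimizer (reg_functional (Tn n) (yn n) (\<alpha>n n) W) D (xn n)"
  shows "\<exists>N\<ge>1. W_bounded D W (xn ` {N..})"
proof -
  define M where "M = \<bar>reg_functional T y \<alpha> W z\<bar> + 1"
  have "reg_functional T y \<alpha> W z < M"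
    by (simp add: M_def)
  then have "eventually (\<lambda>n. reg_functional (Tn n) (yn n) (\<alpha>n n) W z < M) sequentially"
    using reg_functional_tendsto[OF unif y a z] by (rule order_tendstoD(2)[rotated])
  moreover have "eventually (\<lambda>n. \<alpha> / 2 < \<alpha>n n) sequentially"
    using order_tendstoD(1)[OF a, of "\<alpha> / 2"] pos by simp
  ultimately have "eventually (\<lambda>n. reg_functional (Tn n) (yn n) (\<alpha>n n) W z < M
      \<and> \<alpha> / 2 < \<alpha>n n) sequentially"
    by (rule eventually_conj)
  then obtain N where N: "\<And>n. n \<ge> N \<Longrightarrow>
      reg_functional (Tn n) (yn n) (\<alpha>n n) W z < M \<and> \<alpha> / 2 < \<alpha>n n"
    unfolding eventually_sequentially by blast
  have "xn n \<in> D \<and> \<bar>W (xn n)\<bar> \<le> max \<gamma> (2 * M / \<alpha>)" if n: "n \<ge> max N 1" for n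
  proof
    show xD: "xn n \<in> D"
      using min[of n] n by (simp add: is_arg_min_linorder)
    have "\<alpha>n n * W (xn n) \<le> reg_functional (Tn n) (yn n) (\<alpha>n n) W (xn n)"
      by (simp add: reg_functional_def)
    also have "\<dots> \<le> reg_functional (Tn n) (yn n) (\<alpha>n n) W z"
      using min[of n] n z by (simp add: is_arg_min_linorder)
    also have "\<dots> \<le> M"
      using N[of n] n by simp
    finally have le: "\<alpha>n n * W (xn n) \<le> M" .
    have "W (xn n) \<le> 2 * M / \<alpha>"
    proof (cases "W (xn n) \<ge> 0")
      case True
      have "\<alpha> / 2 * W (xn n) \<le> \<alpha>n n * W (xn n)"
        using N[of n] n True by (intro mult_right_mono) auto
      with le pos show ?thesis
        by (simp add: field_simps)
    next
      case False
      have "0 \<le> 2 * M / \<alpha>"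
        using pos by (simp add: M_def)
      with False show ?thesis by linarith
    qed
    with below[OF xD] show "\<bar>W (xn n)\<bar> \<le> max \<gamma> (2 * M / \<alpha>)"
      by linarith
  qed
  then have "W_bounded D W (xn ` {max N 1..})"
    unfolding W_bounded_def by blast
  then show ?thesis
    by (intro exI[of _ "max N 1"]) simp
qed

text \<open>Perturbing the operator and the data does not change the limit of the residuals tested
  against \<open>v\<close>, since the perturbations tend to \<open>0\<close> in norm along a \<open>W\<close>-bounded sequence; and
  \<open>\<lambda>x. v \<bullet> T x\<close> is one of the functionals that test weak convergence.\<close>

lemma inner_residual_tendsto:
  fixes T :: "'a::real_normed_vector \<Rightarrow> 'b::real_inner"
  assumes T: "bounded_linear T"
    and unif: "uniform_on_W_bounded D W Tn T"
    and y: "yn \<longlonglongrightarrow> y"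
    and bdd: "W_bounded D W (range u)" and m: "filterlim m at_top sequentially"
    and weak: "weakly_tendsto u x"
  shows "(\<lambda>j. v \<bullet> (Tn (m j) (u j) - yn (m j))) \<longlonglongrightarrow> v \<bullet> (T x - y)"
proof -
  have "bounded_linear (\<lambda>w. v \<bullet> T w)"
    using bounded_linear_compose[OF bounded_linear_inner_right T] .
  with weak have "(\<lambda>j. v \<bullet> T (u j)) \<longlonglongrightarrow> v \<bullet> T x"
    unfolding weakly_tendsto_def by blast
  moreover have "(\<lambda>j. Tn (m j) (u j) - T (u j)) \<longlonglongrightarrow> 0"
    using unif bdd m by (rule uniform_on_W_bounded_diff_tendsto_0)
  moreover have "(\<lambda>j. yn (m j)) \<longlonglongrightarrow> y"
    using y m by (rule filterlim_compose)
  ultimately have "(\<lambda>j. v \<bullet> T (u j) + v \<bullet> (Tn (m j) (u j) - T (u j)) - v \<bullet> yn (m j))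
      \<longlonglongrightarrow> v \<bullet> T x + v \<bullet> 0 - v \<bullet> y"
    by (rule tendsto_diff[OF tendsto_add[OF _ tendsto_inner[OF tendsto_const]]
          tendsto_inner[OF tendsto_const]])
  then show ?thesis
    by (simp add: inner_diff_right)
qed

text \<open>The values of the perturbed functionals at their minimizers are bounded above by those at a
  fixed \<open>z\<close>, which converge, and below by the linearization of the squared norm at \<open>v = T x - y\<close>
  plus the penalty. The resulting bound is proved with \<open>W x\<close> replaced by any \<open>w < W x\<close>, because lower semicontinuity yields \<open>w < W (u j)\<close> only
  for such \<open>w\<close>.\<close>

lemma weak_limit_of_minimizers:
  fixes T :: "'a::real_normed_vector \<Rightarrow> 'b::real_inner"
  assumes T: "bounded_linear T"
    and unif: "uniform_on_W_bounded D W Tn T"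
    and y: "yn \<longlonglongrightarrow> y" and a: "\<alpha>n \<longlonglongrightarrow> \<alpha>" and pos: "\<alpha> > 0"
    and bdd: "W_bounded D W (range u)" and m: "filterlim m at_top sequentially"
    and min: "\<And>j. is_global_minimizer
       (reg_functional (Tn (m j)) (yn (m j)) (\<alpha>n (m j)) W) D (u j)"
    and weak: "weakly_tendsto u x" and x: "x \<in> D"
    and lsc: "ereal (W x) \<le> liminf (\<lambda>j. ereal (W (u j)))"
  shows "is_global_minimizer (reg_functional T y \<alpha> W) D x"
proof -
  have "reg_functional T y \<alpha> W x \<le> reg_functional T y \<alpha> W z" if z: "z \<in> D" for z
  proof -
    define v where "v = T x - y"
    define p where "p j = Tn (m j) (u j) - yn (m j)" for j
    have a_m: "(\<lambda>j. \<alpha>n (m j)) \<longlonglongrightarrow> \<alpha>"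
      using a m by (rule filterlim_compose)
    have inner_p: "(\<lambda>j. v \<bullet> p j) \<longlonglongrightarrow> v \<bullet> v"
      using inner_residual_tendsto[OF T unif y bdd m weak, of v] by (simp add: p_def v_def)
    have J_z: "(\<lambda>j. reg_functional (Tn (m j)) (yn (m j)) (\<alpha>n (m j)) W z)
        \<longlonglongrightarrow> reg_functional T y \<alpha> W z"
      using reg_functional_tendsto[OF unif y a z] m by (rule filterlim_compose)
    have bound: "(norm v)\<^sup>2 + \<alpha> * w \<le> reg_functional T y \<alpha> W z" if w: "w < W x" for w
    proof -
      have "ereal w < liminf (\<lambda>j. ereal (W (u j)))"
        using w lsc by (auto intro: less_le_trans[of _ "ereal (W x)"])
      then have "eventually (\<lambda>j. w < W (u j)) sequentially"
        using less_LiminfD by fastforce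
      moreover have "eventually (\<lambda>j. 0 < \<alpha>n (m j)) sequentially"
        using a_m pos by (rule order_tendstoD(1))
      ultimately have "eventually (\<lambda>j. 2 * (v \<bullet> p j) - v \<bullet> v + \<alpha>n (m j) * w
          \<le> reg_functional (Tn (m j)) (yn (m j)) (\<alpha>n (m j)) W z) sequentially"
      proof eventually_elim
        case (elim j)
        have "0 \<le> (p j - v) \<bullet> (p j - v)"
          by (rule inner_ge_zero)
        then have "2 * (v \<bullet> p j) - v \<bullet> v \<le> (norm (p j))\<^sup>2"
          by (simp add: inner_diff_left inner_diff_right inner_commute power2_norm_eq_inner)
        moreover have "\<alpha>n (m j) * w \<le> \<alpha>n (m j) * W (u j)"
          using elim by simp
        moreover have "reg_functional (Tn (m j)) (yn (m j)) (\<alpha>n (m j)) W (u j)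
            \<le> reg_functional (Tn (m j)) (yn (m j)) (\<alpha>n (m j)) W z"
          using min[of j] z by (simp add: is_arg_min_linorder)
        ultimately show ?case
          by (simp add: reg_functional_def p_def)
      qed
      moreover have "(\<lambda>j. 2 * (v \<bullet> p j) - v \<bullet> v + \<alpha>n (m j) * w)
          \<longlonglongrightarrow> 2 * (v \<bullet> v) - v \<bullet> v + \<alpha> * w"
        by (intro tendsto_intros inner_p a_m)
      ultimately have "2 * (v \<bullet> v) - v \<bullet> v + \<alpha> * w \<le> reg_functional T y \<alpha> W z"
        using J_z by (intro tendsto_le[OF sequentially_bot J_z])
      then show ?thesis
        by (simp add: power2_norm_eq_inner)
    qed
    have "W x \<le> (reg_functional T y \<alpha> W z - (norm v)\<^sup>2) / \<alpha>"
    proof (rule dense_le)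
      fix w assume "w < W x"
      from bound[OF this] pos show "w \<le> (reg_functional T y \<alpha> W z - (norm v)\<^sup>2) / \<alpha>"
        by (simp add: field_simps)
    qed
    with pos show ?thesis
      by (simp add: reg_functional_def v_def field_simps)
  qed
  with x show ?thesis
    by (simp add: is_arg_min_linorder)
qed

theorem corollary3p4:
  fixes T :: "'a::real_normed_vector \<Rightarrow> 'b::real_inner"
    and Tn :: "nat \<Rightarrow> 'a \<Rightarrow> 'b"
    and y :: 'b and yn :: "nat \<Rightarrow> 'b"
    and \<alpha> :: real and \<alpha>n :: "nat \<Rightarrow> real"
    and D :: "'a set" and W :: "'a \<Rightarrow> real"
    and xbar :: 'a and xn :: "nat \<Rightarrow> 'a"
  assumes T: "bounded_linear T"
    and Tn: "\<And>n. n \<ge> 1 \<Longrightarrow> bounded_linear (Tn n)"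
    and \<alpha>_pos: "\<alpha> > 0"
    and W_bounded_below: "\<exists>\<gamma>\<ge>0. \<forall>x\<in>D. W x \<ge> - \<gamma>"
    and W_lsc: "\<And>s x. \<lbrakk>W_bounded D W (range s); x \<in> D; weakly_tendsto s x\<rbrakk> \<Longrightarrow>
       \<exists>r :: nat \<Rightarrow> nat. strict_mono r \<and>
         ereal (W x) \<le> liminf (\<lambda>j. ereal (W (s (r j))))"
    and W_compact: "\<And>s. W_bounded D W (range s) \<Longrightarrow>
       \<exists>(r :: nat \<Rightarrow> nat) x. strict_mono r \<and> x \<in> D \<and> weakly_tendsto (s \<circ> r) x"
    and \<alpha>n_lim: "\<alpha>n \<longlonglongrightarrow> \<alpha>"
    and yn_lim: "yn \<longlonglongrightarrow> y"
    and Tn_lim: "uniform_on_W_bounded D W Tn T"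
    and xbar_min: "is_global_minimizer (reg_functional T y \<alpha> W) D xbar"
    and xbar_unique: "\<And>z. is_global_minimizer (reg_functional T y \<alpha> W) D z \<Longrightarrow> z = xbar"
    and xn_min: "\<And>n. n \<ge> 1 \<Longrightarrow>
       is_global_minimizer (reg_functional (Tn n) (yn n) (\<alpha>n n) W) D (xn n)"
  shows "weakly_tendsto xn xbar"
proof (rule weakly_tendsto_if_subsequences)
  fix r :: "nat \<Rightarrow> nat"
  assume r: "strict_mono r"
  obtain \<gamma> where below: "\<And>x. x \<in> D \<Longrightarrow> W x \<ge> - \<gamma>"
    using W_bounded_below by blast
  have "xbar \<in> D"
    using xbar_min by (simp add: is_arg_min_linorder)
  from minimizers_eventually_W_bounded[OF Tn_lim yn_lim \<alpha>n_lim \<alpha>_pos below this xn_min]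
  obtain N where N: "N \<ge> 1" and bdd_N: "W_bounded D W (xn ` {N..})"
    by blast
  \<comment> \<open>Shifting by \<open>N\<close> makes the whole subsequence \<open>W\<close>-bounded and keeps its indices \<open>\<ge> 1\<close>.\<close>
  define k where "k j = r (j + N)" for j
  have k: "strict_mono k"
    using r by (simp add: k_def strict_mono_def)
  have k_ge: "k j \<ge> N" for j
    using seq_suble[OF r, of "j + N"] by (simp add: k_def)
  have bdd: "W_bounded D W (range (\<lambda>j. xn (k (g j))))" for g :: "nat \<Rightarrow> nat"
    using bdd_N k_ge by (fastforce simp: W_bounded_def)
  obtain q x where q: "strict_mono q" and x: "x \<in> D"
    and weak: "weakly_tendsto (\<lambda>j. xn (k (q j))) x"
    using W_compact[OF bdd[of id]] by (auto simp: o_def)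
  obtain r' where r': "strict_mono r'"
    and lsc: "ereal (W x) \<le> liminf (\<lambda>j. ereal (W (xn (k (q (r' j))))))"
    using W_lsc[OF bdd[of q] x weak] by blast
  have weak': "weakly_tendsto (\<lambda>j. xn (k (q (r' j)))) x"
    using weakly_tendsto_subseq[OF weak r'] by (simp add: o_def)
  have "strict_mono (\<lambda>j. k (q (r' j)))"
    using k q r' by (simp add: strict_mono_def)
  then have m: "filterlim (\<lambda>j. k (q (r' j))) at_top sequentially"
    by (rule filterlim_subseq)
  have min: "is_global_minimizer (reg_functional (Tn (k (q (r' j)))) (yn (k (q (r' j))))
      (\<alpha>n (k (q (r' j)))) W) D (xn (k (q (r' j))))" for j
    using xn_min k_ge[of "q (r' j)"] N by simp
  have "is_global_minimizer (reg_functional T y \<alpha> W) D x"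
    using weak_limit_of_minimizers[OF T Tn_lim yn_lim \<alpha>n_lim \<alpha>_pos bdd[of "q \<circ> r'", unfolded o_def]
        m min weak' x lsc] .
  then have "x = xbar"
    by (rule xbar_unique)
  moreover have "strict_mono (\<lambda>j. q (r' j) + N)"
    using q r' by (simp add: strict_mono_def)
  ultimately show "\<exists>q :: nat \<Rightarrow> nat. strict_mono q \<and> weakly_tendsto (xn \<circ> r \<circ> q) xbar"
    using weak' by (intro exI[of _ "\<lambda>j. q (r' j) + N"]) (simp add: o_def k_def)
qed

end
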